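(* Let a dominated model $\mathscr{P}$ and a prior $\Pi$ be given, let $X_1,X_2,\ldots$ be i.i.d.-$P_0$, and assume that $P_0^n\ll P_n^\Pi$ for all $n\geq1$. Let $V$ be a (measurable) model subset, with a countable cover $V_1,V_2,\ldots$ by model subsets, and let $B\subset\mathscr{P}$ be such that $\Pi(B)>0$ and for all $i\geq1$ and $P\in V_i$, $\sup_{Q\in B}P_0(dP/dQ)<\infty$. Furthermore, assume that \[ \sup_{i\geq1}\ \sup_{P\in\mathrm{co}(V_i)}\ \sup_{Q\in B}P_0\Bigl(\frac{dP}{dQ}\Bigr)^{1/2}<1. \] If the prior satisfies the summability condition $\sum_{i\geq1}\Pi(V_i)^{1/2}<\infty$, then the posterior satisfies $\Pi(V\mid X_1,\ldots,X_n)\to0$, $P_0$-almost surely.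
   Context: Setting. $(\mathscr{X},\mathscr{A})$ is a measurable space (the sample space). The model $\mathscr{P}$ is a collection of probability measures on $(\mathscr{X},\mathscr{A})$ dominated by a $\sigma$-finite measure $\mu$, with densities $p=dP/d\mu$; it carries a $\sigma$-algebra $\mathscr{B}$ such that $P\mapsto P(A)$ is measurable for every $A\in\mathscr{A}$ (densities are taken measurable in $(x,P)$, and model subsets to which $\Pi$ is applied are measurable). The prior $\Pi$ is a probability measure on $(\mathscr{P},\mathscr{B})$; $P_0$ is a probability measure on $(\mathscr{X},\mathscr{A})$. Notation: $P_0f=\int f\,dP_0$. The prior predictive distributions are $P_n^\Pi(A)=\int P^n(A)\,d\Pi(P)$. The posterior is \[ \Pi(A\mid X_1,\ldots,X_n)=\int_A\prod_{i=1}^n p(X_i)\,d\Pi(P)\Bigm/\int_{\mathscr{P}}\prod_{i=1}^n p(X_i)\,d\Pi(P). \] "$P_0$-almost surely" refers to $P_0^\infty$. $\mathrm{co}(V)$ is the convex hull of $V$. Conventions: $P_0(dP/dQ)^\alpha=\int_{\{p_0>0,\,p>0\}}(p/q)^\alpha\,dP_0$; finiteness of $P_0(dP/dQ)$ includes that $q>0$ $P_0$-almost everywhere on $\{p>0\}$. *)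

theory Defs
  imports "HOL-Probability.Probability"
begin

text \<open>
  The model and its \<sigma>-algebra are \<^term>\<open>space prior\<close> and \<^term>\<open>sets prior\<close>, so that the prior is a measure
  on a set of measures. The function \<open>p\<close> selects, for every \<open>P\<close> in the model, a version of the
  density \<open>dP/d\<mu>\<close>; in particular \<open>P\<close> lives on the measurable space of \<open>\<mu>\<close>.
\<close>

locale dominated_model =
  dominating: sigma_finite_measure mu + prior_space: prob_space prior
  for mu :: "'a measure" and prior :: "'a measure measure" and p :: "'a measure \<Rightarrow> 'a \<Rightarrow> ennreal" +
  assumes prob_space_model: "P \<in> space prior \<Longrightarrow> prob_space P"
    and density_model: "P \<in> space prior \<Longrightarrow> P = density mu (p P)"
    and measurable_emeasure_model: "A \<in> sets mu \<Longrightarrow> (\<lambda>P. emeasure P A) \<in> borel_measurable prior"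
    and measurable_density_model: "(\<lambda>(x, P). p P x) \<in> borel_measurable (mu \<Otimes>\<^sub>M prior)"

definition prior_predictive :: "'a measure \<Rightarrow> 'a measure measure \<Rightarrow> nat \<Rightarrow> (nat \<Rightarrow> 'a) measure" where
  "prior_predictive mu prior n =
     measure_of (space (Pi\<^sub>M {..<n} (\<lambda>_. mu))) (sets (Pi\<^sub>M {..<n} (\<lambda>_. mu)))
       (\<lambda>A. \<integral>\<^sup>+ P. emeasure (Pi\<^sub>M {..<n} (\<lambda>_. P)) A \<partial>prior)"

definition posterior ::
  "'a measure measure \<Rightarrow> ('a measure \<Rightarrow> 'a \<Rightarrow> ennreal) \<Rightarrow> nat \<Rightarrow> (nat \<Rightarrow> 'a) \<Rightarrow> 'a measure set \<Rightarrow> ennreal"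
where
  "posterior prior p n x A =
     (\<integral>\<^sup>+ P\<in>A. (\<Prod>i<n. p P (x i)) \<partial>prior) / (\<integral>\<^sup>+ P. (\<Prod>i<n. p P (x i)) \<partial>prior)"

text \<open>
  Measures do not form a vector space, so the library's convex hull does not apply; the finite convex
  combinations are formed setwise.
\<close>

definition convex_hull_measures :: "'a measure set \<Rightarrow> 'a measure set" where
  "convex_hull_measures V =
     {R. \<exists>S w. finite S \<and> S \<subseteq> V \<and> (\<forall>P\<in>S. 0 \<le> w P) \<and> (\<Sum>P\<in>S. w P) = (1 :: real) \<and>
           (\<forall>P\<in>S. sets R = sets P) \<and>
           (\<forall>A\<in>sets R. emeasure R A = (\<Sum>P\<in>S. ennreal (w P) * emeasure P A))}"

text \<open>Used for positive exponents only.\<close>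

definition ennpowr :: "ennreal \<Rightarrow> real \<Rightarrow> ennreal" where
  "ennpowr x a = (if x = \<infinity> then \<infinity> else ennreal (enn2real x powr a))"

text \<open>
  The integral \<open>P0 (dP/dQ)\<^sup>a\<close>, over the set where the \<open>\<mu>\<close>-densities of \<open>P0\<close> and \<open>P\<close> are positive.
  For \<open>P0\<close>, \<open>P\<close> and \<open>Q\<close> dominated by \<open>\<mu>\<close> it does not depend on the versions of the densities. Where the
  density of \<open>P\<close> is positive and that of \<open>Q\<close> vanishes, the ratio in \<^typ>\<open>ennreal\<close> is infinite, so a
  finite value forces the density of \<open>Q\<close> to be positive \<open>P0\<close>-almost everywhere on that set.
\<close>

definition ratio_moment :: "'a measure \<Rightarrow> 'a measure \<Rightarrow> 'a measure \<Rightarrow> 'a measure \<Rightarrow> real \<Rightarrow> ennreal" where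
  "ratio_moment mu P0 P Q a =
     (\<integral>\<^sup>+ x\<in>{x \<in> space mu. 0 < RN_deriv mu P0 x \<and> 0 < RN_deriv mu P x}.
        ennpowr (RN_deriv mu P x / RN_deriv mu Q x) a \<partial>P0)"

context dominated_model
begin

lemma sets_model: "P \<in> space prior \<Longrightarrow> sets P = sets mu"
  by (metis density_model sets_density)

lemma measurable_product_model:
  "(\<lambda>P. Pi\<^sub>M {..<n} (\<lambda>_. P)) \<in> prior \<rightarrow>\<^sub>M prob_algebra (Pi\<^sub>M {..<n} (\<lambda>_::nat. mu))"
proof (rule measurable_prob_algebra_generated[OF sets_PiM Int_stable_prod_algebra prod_algebra_sets_into_space])
  fix P assume PS: "P \<in> space prior"
  then interpret prob_space P by (rule prob_space_model)
  interpret product_prob_space "\<lambda>_::nat. P" "{..<n}" by standard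
  show "prob_space (Pi\<^sub>M {..<n} (\<lambda>_. P))" by (rule prob_space_axioms)
  show "sets (Pi\<^sub>M {..<n} (\<lambda>_. P)) = sets (Pi\<^sub>M {..<n} (\<lambda>_. mu))"
    using sets_model[OF PS] by (intro sets_PiM_cong) auto
next
  fix A assume "A \<in> prod_algebra {..<n} (\<lambda>_::nat. mu)"
  then obtain E where A: "A = Pi\<^sub>E {..<n} E" and E: "E \<in> {..<n} \<rightarrow> sets mu"
    by (elim prod_algebraE_all) auto
  have eq: "emeasure (Pi\<^sub>M {..<n} (\<lambda>_. P)) A = (\<Prod>i<n. emeasure P (E i))" if PS: "P \<in> space prior" for P
  proof -
    interpret prob_space P using PS by (rule prob_space_model)
    interpret finite_product_prob_space "\<lambda>_::nat. P" "{..<n}" by standard auto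
    show ?thesis unfolding A using E sets_model[OF PS] by (intro emeasure_PiM) auto
  qed
  show "(\<lambda>P. emeasure (Pi\<^sub>M {..<n} (\<lambda>_. P)) A) \<in> borel_measurable prior"
    using E by (subst measurable_cong[OF eq]) (auto intro!: borel_measurable_prod_ennreal measurable_emeasure_model)
qed

lemma sets_prior_predictive: "sets (prior_predictive mu prior n) = sets (Pi\<^sub>M {..<n} (\<lambda>_. mu))"
  unfolding prior_predictive_def by (simp add: sets.space_closed)

lemma emeasure_prior_predictive:
  assumes A: "A \<in> sets (Pi\<^sub>M {..<n} (\<lambda>_. mu))"
  shows "emeasure (prior_predictive mu prior n) A = (\<integral>\<^sup>+ P. emeasure (Pi\<^sub>M {..<n} (\<lambda>_. P)) A \<partial>prior)"
proof -
  let ?N = "Pi\<^sub>M {..<n} (\<lambda>_::nat. mu)"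
  let ?m = "\<lambda>A. \<integral>\<^sup>+ P. emeasure (Pi\<^sub>M {..<n} (\<lambda>_. P)) A \<partial>prior"
  have s: "sets (Pi\<^sub>M {..<n} (\<lambda>_. P)) = sets ?N" if "P \<in> space prior" for P
    using sets_model[OF that] by (intro sets_PiM_cong) auto
  have meas: "(\<lambda>P. emeasure (Pi\<^sub>M {..<n} (\<lambda>_. P)) A) \<in> borel_measurable prior" if "A \<in> sets ?N" for A
    using measurable_prob_algebraD[OF measurable_product_model] that
    by (rule measurable_emeasure_kernel)
  have "countably_additive (sets ?N) ?m"
  proof (rule countably_additiveI)
    fix F :: "nat \<Rightarrow> (nat \<Rightarrow> 'a) set"
    assume F: "range F \<subseteq> sets ?N" "disjoint_family F"
    have "(\<Sum>i. ?m (F i)) = (\<integral>\<^sup>+ P. (\<Sum>i. emeasure (Pi\<^sub>M {..<n} (\<lambda>_. P)) (F i)) \<partial>prior)"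
      using F by (intro nn_integral_suminf[symmetric] meas) auto
    also have "\<dots> = ?m (\<Union>i. F i)"
      using F s by (intro nn_integral_cong suminf_emeasure) auto
    finally show "(\<Sum>i. ?m (F i)) = ?m (\<Union>i. F i)" .
  qed
  then show ?thesis
    using A sets.sigma_algebra_axioms
    by (intro emeasure_measure_of[OF prior_predictive_def])
      (auto simp: positive_def sets.space_closed sets_prior_predictive dest: sets.sets_into_space)
qed

end

end

theory Submission
  imports Defs
begin

text \<open>
  Since the posterior mass \<open>\<Pi>(W i | x)\<close> is at most one, it is bounded by its square root. Shrinking
  its denominator to the integral over \<open>B\<close> and applying Jensen's inequality to \<open>y powr (-1/2)\<close> bounds
  its \<open>P0\<close>-mean by an average over \<open>Q \<in> B\<close> of the \<open>P0\<close>-means of square roots of mixed likelihood ratios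
  \<open>\<integral> (\<Prod>i<n. p P (x i) / p Q (x i)) d\<Pi>(P)\<close>, with \<open>P\<close> ranging over \<open>W i\<close>. Given the
  preceding observations, the last factor is averaged over a reweighted prior on \<open>W i\<close>; as mixtures are limits of
  finite convex combinations, the Hellinger-type bound \<open>\<rho> < 1\<close> holds for it, and by induction each mean is
  at most \<open>\<rho>\<^sup>n \<Pi>(W i)\<^sup>1\<^sup>/\<^sup>2\<close>. Summing over \<open>i\<close> and \<open>n\<close>, the series of posterior masses of
  \<open>V\<close> has finite mean, so its terms tend to zero almost surely.
\<close>

section \<open>Square roots on the extended nonnegative reals\<close>

abbreviation esqrt :: "ennreal \<Rightarrow> ennreal" where
  "esqrt x \<equiv> ennpowr x (1/2)"

lemma esqrt_ennreal: "0 \<le> r \<Longrightarrow> esqrt (ennreal r) = ennreal (sqrt r)"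
  by (simp add: ennpowr_def powr_half_sqrt)

text \<open>The square root is adjoint to squaring. In this form monotonicity and the bound for
  suprema need no case distinction between finite and infinite values.\<close>

lemma esqrt_le_iff: "esqrt x \<le> y \<longleftrightarrow> x \<le> y * y"
proof (cases x rule: ennreal_cases)
  case x: (real r)
  show ?thesis
  proof (cases y rule: ennreal_cases)
    case (real s)
    then show ?thesis
      using x by (simp add: esqrt_ennreal ennreal_mult[symmetric] real_sqrt_le_iff' power2_eq_square)
  qed (simp add: x)
qed (auto simp: ennpowr_def ennreal_mult_eq_top_iff top_unique)

lemma esqrt_square: "esqrt x * esqrt x = x"
  by (cases x rule: ennreal_cases)
     (simp_all add: esqrt_ennreal ennreal_mult[symmetric], simp add: ennpowr_def)

lemma esqrt_mono: "x \<le> y \<Longrightarrow> esqrt x \<le> esqrt y"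
  by (simp add: esqrt_le_iff esqrt_square)

lemma esqrt_eqI: "x = y * y \<Longrightarrow> esqrt x = y"
  by (cases y rule: ennreal_cases)
     (simp_all add: esqrt_ennreal ennreal_mult[symmetric], simp add: ennpowr_def)

lemma esqrt_mult: "esqrt (x * y) = esqrt x * esqrt y"
proof (rule esqrt_eqI)
  have "esqrt x * esqrt y * (esqrt x * esqrt y) = esqrt x * esqrt x * (esqrt y * esqrt y)"
    by (simp only: ac_simps)
  then show "x * y = esqrt x * esqrt y * (esqrt x * esqrt y)"
    by (simp only: esqrt_square)
qed

lemma esqrt_0 [simp]: "esqrt 0 = 0"
  and esqrt_1 [simp]: "esqrt 1 = 1"
  and esqrt_top [simp]: "esqrt top = top"
proof -
  show "esqrt 0 = 0" by (rule esqrt_eqI) simp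
  show "esqrt 1 = 1" by (rule esqrt_eqI) simp
  show "esqrt top = top" by (rule esqrt_eqI) (simp add: ennreal_top_mult)
qed

lemma esqrt_SUP: "esqrt (SUP i\<in>I. f i) \<le> (SUP i\<in>I. esqrt (f i))"
  unfolding esqrt_le_iff
proof (rule SUP_least)
  fix i assume "i \<in> I"
  then have "esqrt (f i) * esqrt (f i) \<le> (SUP i\<in>I. esqrt (f i)) * (SUP i\<in>I. esqrt (f i))"
    by (intro mult_mono SUP_upper) auto
  then show "f i \<le> (SUP i\<in>I. esqrt (f i)) * (SUP i\<in>I. esqrt (f i))"
    by (simp only: esqrt_square)
qed

text \<open>Multiply \<open>esqrt x \<le> 1\<close> by \<open>esqrt x\<close>. This is what lets a
  posterior mass be replaced by its square root.\<close>

lemma esqrt_ge_self: "x \<le> 1 \<Longrightarrow> x \<le> esqrt x"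
  using mult_left_mono[OF esqrt_mono[of x 1], of "esqrt x"] by (simp add: esqrt_square)

lemma measurable_ennpowr [measurable]: "(\<lambda>x. ennpowr x a) \<in> borel_measurable borel"
  unfolding ennpowr_def by measurable

section \<open>Mixtures as limits of finite convex combinations\<close>

text \<open>If \<open>\<phi>\<close> exceeded \<open>c\<close> on all of \<open>V\<close>, its mean
  would exceed \<open>c\<close> too; \<open>c < \<infinity>\<close> makes the strict comparison of
  integrals valid. This selects the next point in the greedy construction below.\<close>

lemma exists_le_nn_integral:
  assumes "prob_space N" "AE P in N. P \<in> V" "\<phi> \<in> borel_measurable N" "(\<integral>\<^sup>+P. \<phi> P \<partial>N) \<le> c" "c < \<infinity>"
  shows "\<exists>P\<in>V. \<phi> P \<le> c"
proof (rule ccontr)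
  interpret prob_space N by fact
  assume "\<not> ?thesis"
  then have gt: "AE P in N. c < \<phi> P"
    using assms(2) by (auto simp: not_le)
  have "(\<integral>\<^sup>+P. c \<partial>N) < (\<integral>\<^sup>+P. \<phi> P \<partial>N)"
  proof (rule nn_integral_less)
    show "\<not> (AE P in N. \<phi> P \<le> c)"
    proof
      assume "AE P in N. \<phi> P \<le> c"
      with gt have "AE P in N. False" by eventually_elim simp
      then show False by simp
    qed
    show "AE P in N. c \<le> \<phi> P" using gt by eventually_elim simp
  qed (use assms in \<open>auto simp: emeasure_space_1\<close>)
  then show False using assms(4) by (simp add: emeasure_space_1)
qed

text \<open>
  The points are chosen greedily: for \<open>P\<close> drawn from \<open>N\<close> the cross term with the partial sum has mean
  zero, so some choice raises the squared \<open>L\<^sup>2\<close> norm by at most \<open>K\<^sup>2\<close> times the mass of \<open>M\<close>.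
\<close>

lemma average_approximates_mixture:
  fixes f :: "'a \<Rightarrow> 'b \<Rightarrow> real"
  assumes M: "finite_measure M" and N: "prob_space N"
    and f [measurable]: "(\<lambda>(x, P). f x P) \<in> borel_measurable (M \<Otimes>\<^sub>M N)"
    and f0: "\<And>x P. 0 \<le> f x P" and fK: "\<And>x P. f x P \<le> K"
    and V: "V \<subseteq> space N" "AE P in N. P \<in> V"
  shows "\<exists>y. (\<forall>j<m. y j \<in> V) \<and>
    (\<integral>\<^sup>+x. ennreal ((\<Sum>j<m. f x (y j) - (\<integral>P. f x P \<partial>N))\<^sup>2) \<partial>M) \<le> ennreal (real m * (K\<^sup>2 * measure M (space M)))"
proof (induction m)
  case 0
  show ?case by simp
next
  case (Suc m)
  interpret M: finite_measure M by fact
  interpret N: prob_space N by fact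
  interpret pair_sigma_finite M N ..
  define g where "g x = (\<integral>P. f x P \<partial>N)" for x
  have g [measurable]: "g \<in> borel_measurable M"
    unfolding g_def by measurable
  have fx [measurable]: "(\<lambda>x. f x P) \<in> borel_measurable M" if "P \<in> space N" for P
    using measurable_compose[OF measurable_Pair2'[OF that] f] by simp
  have fP [measurable]: "f x \<in> borel_measurable N" if "x \<in> space M" for x
    using measurable_compose[OF measurable_Pair1'[OF that] f] by simp
  obtain y where y: "\<And>j. j < m \<Longrightarrow> y j \<in> V"
    and le: "(\<integral>\<^sup>+x. ennreal ((\<Sum>j<m. f x (y j) - g x)\<^sup>2) \<partial>M) \<le> ennreal (real m * (K\<^sup>2 * measure M (space M)))"
    using Suc unfolding g_def by blast
  define s where "s x = (\<Sum>j<m. f x (y j) - g x)" for x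
  have s [measurable]: "s \<in> borel_measurable M"
    unfolding s_def using y V by (intro borel_measurable_sum borel_measurable_diff fx g) auto
  have int: "integrable N (f x)" if "x \<in> space M" for x
    using f0 fK that by (intro N.integrable_const_bound[where B=K]) auto
  have int2: "integrable N (\<lambda>P. (f x P)\<^sup>2)" if "x \<in> space M" for x
    using f0 fK that by (intro N.integrable_const_bound[where B="K\<^sup>2"]) (auto intro!: AE_I2 power_mono)
  have var: "(\<integral>\<^sup>+P. ennreal ((s x + (f x P - g x))\<^sup>2) \<partial>N) \<le> ennreal ((s x)\<^sup>2) + ennreal (K\<^sup>2)"
    if x: "x \<in> space M" for x
  proof -
    \<comment> \<open>Expanding in powers of \<open>f x P\<close> reduces integrability to that of
      \<open>f x\<close> and its square.\<close>
    have eq: "(s x + (f x P - g x))\<^sup>2 = (s x - g x)\<^sup>2 + 2 * (s x - g x) * f x P + (f x P)\<^sup>2" for P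
      by (simp add: power2_eq_square algebra_simps)
    have "(\<integral>\<^sup>+P. ennreal ((s x + (f x P - g x))\<^sup>2) \<partial>N) = ennreal (\<integral>P. (s x + (f x P - g x))\<^sup>2 \<partial>N)"
    proof (rule nn_integral_eq_integral)
      show "integrable N (\<lambda>P. (s x + (f x P - g x))\<^sup>2)"
        unfolding eq using int[OF x] int2[OF x] by simp
    qed simp
    also have "\<dots> \<le> ennreal ((s x)\<^sup>2 + K\<^sup>2)"
    proof (rule ennreal_leI)
      have "(\<integral>P. (s x + (f x P - g x))\<^sup>2 \<partial>N) = (s x - g x)\<^sup>2 + 2 * (s x - g x) * g x + (\<integral>P. (f x P)\<^sup>2 \<partial>N)"
        unfolding eq using int[OF x] int2[OF x] by (simp add: g_def N.prob_space)
      \<comment> \<open>The first two terms sum to \<open>(s x)\<^sup>2 - (g x)\<^sup>2\<close>: the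
        cross term between \<open>s x\<close> and the centred \<open>f x P - g x\<close> has
        integrated to zero.\<close>
      also have "\<dots> \<le> (s x)\<^sup>2 + (\<integral>P. (f x P)\<^sup>2 \<partial>N)"
        by (simp add: power2_eq_square algebra_simps)
      also have "(\<integral>P. (f x P)\<^sup>2 \<partial>N) \<le> K\<^sup>2"
        using f0 fK by (intro N.integral_le_const int2[OF x]) (auto intro!: AE_I2 power_mono)
      finally show "(\<integral>P. (s x + (f x P - g x))\<^sup>2 \<partial>N) \<le> (s x)\<^sup>2 + K\<^sup>2" by simp
    qed
    finally show ?thesis by simp
  qed
  define \<phi> where "\<phi> P = (\<integral>\<^sup>+x. ennreal ((s x + (f x P - g x))\<^sup>2) \<partial>M)" for P
  have "(\<integral>\<^sup>+P. \<phi> P \<partial>N) = (\<integral>\<^sup>+x. \<integral>\<^sup>+P. ennreal ((s x + (f x P - g x))\<^sup>2) \<partial>N \<partial>M)"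
    unfolding \<phi>_def by (rule Fubini') measurable
  also have "\<dots> \<le> (\<integral>\<^sup>+x. ennreal ((s x)\<^sup>2) + ennreal (K\<^sup>2) \<partial>M)"
    by (intro nn_integral_mono var)
  also have "\<dots> = (\<integral>\<^sup>+x. ennreal ((s x)\<^sup>2) \<partial>M) + ennreal (K\<^sup>2 * measure M (space M))"
    by (subst nn_integral_add) (auto simp: M.emeasure_eq_measure ennreal_mult)
  also have "\<dots> \<le> ennreal (real m * (K\<^sup>2 * measure M (space M))) + ennreal (K\<^sup>2 * measure M (space M))"
    using le unfolding s_def by (intro add_right_mono)
  also have "\<dots> = ennreal (real (Suc m) * (K\<^sup>2 * measure M (space M)))"
    by (simp add: ennreal_plus[symmetric] algebra_simps del: ennreal_plus)
  finally have "\<exists>P\<in>V. \<phi> P \<le> ennreal (real (Suc m) * (K\<^sup>2 * measure M (space M)))"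
    by (intro exists_le_nn_integral[OF N V(2)]) (auto simp: \<phi>_def)
  then obtain P where P: "P \<in> V" and le': "\<phi> P \<le> ennreal (real (Suc m) * (K\<^sup>2 * measure M (space M)))"
    by blast
  have "(\<Sum>j<Suc m. f x ((y(m := P)) j) - g x) = s x + (f x P - g x)" for x
    by (simp add: s_def)
  with y P le' show ?case
    by (intro exI[of _ "y(m := P)"]) (auto simp: less_Suc_eq \<phi>_def g_def[symmetric])
qed

text \<open>With \<open>t = sqrt \<bar>a - g\<bar>\<close>, the root of \<open>g\<close> exceeds
  that of \<open>a\<close> by at most \<open>t\<close>, and either \<open>t \<le> \<epsilon>\<close>
  or \<open>(t / \<epsilon>) ^ 3 > 1\<close>, so that \<open>t \<le> t ^ 4 / \<epsilon> ^ 3\<close>.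
  Since \<open>t ^ 4\<close> is the squared distance, a mean-square bound on \<open>a - g\<close>
  controls the mean of the square roots.\<close>

lemma sqrt_le_add_quartic:
  fixes g a \<epsilon> :: real
  assumes "0 \<le> g" "0 \<le> a" "0 < \<epsilon>"
  shows "sqrt g \<le> sqrt a + (\<epsilon> + (a - g)\<^sup>2 / \<epsilon> ^ 3)"
proof -
  define t where "t = sqrt \<bar>a - g\<bar>"
  have t0: "0 \<le> t" by (simp add: t_def)
  have t2: "t\<^sup>2 = \<bar>a - g\<bar>" by (simp add: t_def)
  then have t4: "t ^ 4 = (a - g)\<^sup>2"
    by (metis numeral_Bit0 power2_abs power_add power2_eq_square)
  have "sqrt g \<le> sqrt (a + \<bar>a - g\<bar>)" by simp
  also have "\<dots> \<le> sqrt a + t"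
    unfolding t_def using assms by (intro sqrt_add_le_add_sqrt) auto
  finally have "sqrt g \<le> sqrt a + t" .
  moreover have "t \<le> \<epsilon> + t ^ 4 / \<epsilon> ^ 3"
  proof (cases "t \<le> \<epsilon>")
    case True
    then show ?thesis using t0 assms by (simp add: add_increasing2)
  next
    case False
    then have "t * \<epsilon> ^ 3 \<le> t * t ^ 3"
      using t0 assms by (intro mult_left_mono power_mono) auto
    then have "t \<le> t ^ 4 / \<epsilon> ^ 3"
      using assms by (simp add: pos_le_divide_eq power_Suc[symmetric] eval_nat_numeral)
    then show ?thesis using assms by simp
  qed
  ultimately show ?thesis by (simp add: t4)
qed

text \<open>The chosen points may repeat, while the hull is formed over sets: the weight of
  \<open>P\<close> is its multiplicity among the \<open>y j\<close> divided by
  \<open>m\<close>.\<close>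

lemma average_eq_convex_combination:
  assumes "0 < m" "\<And>j. j < m \<Longrightarrow> y j \<in> V"
  obtains S w where "finite S" "S \<subseteq> V" "\<forall>P\<in>S. 0 \<le> w P" "(\<Sum>P\<in>S. w P) = (1::real)"
    "\<And>h :: _ \<Rightarrow> ennreal. (\<Sum>P\<in>S. ennreal (w P) * h P) = (\<Sum>j<m. ennreal (1 / real m) * h (y j))"
proof
  let ?w = "\<lambda>P. real (card {j \<in> {..<m}. y j = P}) / real m"
  have "real m = (\<Sum>j<m. 1)" by simp
  also have "\<dots> = (\<Sum>P\<in>y ` {..<m}. \<Sum>j\<in>{j \<in> {..<m}. y j = P}. 1)"
    by (rule sum.image_gen) simp
  finally show "(\<Sum>P\<in>y ` {..<m}. ?w P) = 1"
    using assms(1) by (simp add: sum_divide_distrib[symmetric])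
  show "(\<Sum>P\<in>y ` {..<m}. ennreal (?w P) * h P) = (\<Sum>j<m. ennreal (1 / real m) * h (y j))"
    for h :: "_ \<Rightarrow> ennreal"
  proof -
    have "(\<Sum>j<m. ennreal (1 / real m) * h (y j)) =
      (\<Sum>P\<in>y ` {..<m}. \<Sum>j\<in>{j \<in> {..<m}. y j = P}. ennreal (1 / real m) * h (y j))"
      by (rule sum.image_gen) simp
    also have "\<dots> = (\<Sum>P\<in>y ` {..<m}. \<Sum>j\<in>{j \<in> {..<m}. y j = P}. ennreal (1 / real m) * h P)"
      by (intro sum.cong) auto
    also have "\<dots> = (\<Sum>P\<in>y ` {..<m}. ennreal (?w P) * h P)"
      by (intro sum.cong refl)
         (simp add: mult.assoc[symmetric] ennreal_of_nat_eq_real_of_nat ennreal_mult[symmetric])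
    finally show ?thesis by simp
  qed
qed (use assms in auto)

text \<open>Averages over \<open>m\<close> points obey the bound \<open>\<rho>\<close> by
  \<open>H\<close>, and for large \<open>m\<close> they approximate the mixture in mean square;
  \<open>sqrt_le_add_quartic\<close> carries this over to square roots with an error of at most
  \<open>e\<close>.\<close>

lemma nn_integral_esqrt_bounded_mixture_le:
  fixes f :: "'a \<Rightarrow> 'b \<Rightarrow> real"
  assumes M: "finite_measure M" and N: "prob_space N"
    and f [measurable]: "(\<lambda>(x, P). f x P) \<in> borel_measurable (M \<Otimes>\<^sub>M N)"
    and f0: "\<And>x P. 0 \<le> f x P" and fK: "\<And>x P. f x P \<le> K"
    and V: "V \<subseteq> space N" "AE P in N. P \<in> V"
    and H: "\<And>S w. finite S \<Longrightarrow> S \<subseteq> V \<Longrightarrow> \<forall>P\<in>S. 0 \<le> w P \<Longrightarrow> (\<Sum>P\<in>S. w P) = (1::real) \<Longrightarrow>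
      (\<integral>\<^sup>+x. esqrt (\<Sum>P\<in>S. ennreal (w P) * ennreal (f x P)) \<partial>M) \<le> \<rho>"
  shows "(\<integral>\<^sup>+x. esqrt (ennreal (\<integral>P. f x P \<partial>N)) \<partial>M) \<le> \<rho>"
proof (rule ennreal_le_epsilon)
  interpret M: finite_measure M by fact
  interpret N: prob_space N by fact
  interpret pair_sigma_finite M N ..
  fix e :: real assume "0 < e"
  define c where "c = measure M (space M)"
  have c: "0 \<le> c" by (simp add: c_def)
  \<comment> \<open>The constant error \<open>\<epsilon>\<close> is integrated over the total mass
    \<open>c\<close> and may cost \<open>e / 2\<close>; the \<open>+ 1\<close> covers
    \<open>c = 0\<close>.\<close>
  define \<epsilon> where "\<epsilon> = e / (2 * (c + 1))"
  have \<epsilon>: "0 < \<epsilon>" using \<open>0 < e\<close> c by (simp add: \<epsilon>_def)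
  have \<epsilon>c: "\<epsilon> * c \<le> e / 2"
    using \<open>0 < e\<close> c by (simp add: \<epsilon>_def field_simps)
  \<comment> \<open>The squared sum of deviations has integral at most
    \<open>real m * (K\<^sup>2 * c)\<close>; division by \<open>real m ^ 2\<close> and by
    \<open>\<epsilon> ^ 3\<close> leaves at most \<open>e / 2\<close> for this \<open>m\<close>. The
    \<open>+ 1\<close> forces \<open>0 < m\<close>.\<close>
  obtain m where m: "2 * K\<^sup>2 * c / (\<epsilon> ^ 3 * e) + 1 < real m"
    using reals_Archimedean2 by blast
  have "0 \<le> 2 * K\<^sup>2 * c / (\<epsilon> ^ 3 * e)" using c \<epsilon> \<open>0 < e\<close> by simp
  with m have m0: "0 < m" by (cases m) auto
  have me: "K\<^sup>2 * c / (real m * \<epsilon> ^ 3) \<le> e / 2"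
  proof -
    have "2 * K\<^sup>2 * c / (\<epsilon> ^ 3 * e) \<le> real m" using m by simp
    then have "2 * K\<^sup>2 * c \<le> real m * (\<epsilon> ^ 3 * e)"
      using \<epsilon> \<open>0 < e\<close> by (simp add: pos_divide_le_eq)
    also have "real m * (\<epsilon> ^ 3 * e) = 2 * (e / 2 * (real m * \<epsilon> ^ 3))" by simp
    finally have "K\<^sup>2 * c \<le> e / 2 * (real m * \<epsilon> ^ 3)" by linarith
    then show ?thesis
      using \<epsilon> m0 by (subst pos_divide_le_eq) auto
  qed
  define g where "g x = (\<integral>P. f x P \<partial>N)" for x
  have g [measurable]: "g \<in> borel_measurable M"
    unfolding g_def by measurable
  have fx [measurable]: "(\<lambda>x. f x P) \<in> borel_measurable M" if "P \<in> space N" for P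
    using measurable_compose[OF measurable_Pair2'[OF that] f] by simp
  obtain y where y: "\<And>j. j < m \<Longrightarrow> y j \<in> V"
    and L2: "(\<integral>\<^sup>+x. ennreal ((\<Sum>j<m. f x (y j) - g x)\<^sup>2) \<partial>M) \<le> ennreal (real m * (K\<^sup>2 * c))"
    using average_approximates_mixture[OF M N f f0 fK V, of m] unfolding g_def c_def by blast
  have yN: "y j \<in> space N" if "j < m" for j using y[OF that] V by auto
  obtain S w where S: "finite S" "S \<subseteq> V" "\<forall>P\<in>S. 0 \<le> w P" "(\<Sum>P\<in>S. w P) = (1::real)"
    and avg: "\<And>h :: _ \<Rightarrow> ennreal. (\<Sum>P\<in>S. ennreal (w P) * h P) = (\<Sum>j<m. ennreal (1 / real m) * h (y j))"
    by (rule average_eq_convex_combination[OF m0 y]) (assumption | rule that)+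
  define d where "d x = (\<Sum>j<m. f x (y j) - g x)" for x
  have d [measurable]: "d \<in> borel_measurable M"
    unfolding d_def using yN by (intro borel_measurable_sum borel_measurable_diff fx g) auto
  define A where "A x = (\<Sum>P\<in>S. ennreal (w P) * ennreal (f x P))" for x
  have A [measurable]: "A \<in> borel_measurable M"
    unfolding A_def
  proof (intro borel_measurable_sum borel_measurable_times_ennreal borel_measurable_const)
    fix P assume "P \<in> S"
    with S(2) V(1) have "P \<in> space N" by auto
    then show "(\<lambda>x. ennreal (f x P)) \<in> borel_measurable M" by measurable
  qed
  \<comment> \<open>With \<open>a\<close> the average of the \<open>f x (y j)\<close>, the deviation
    \<open>a - g x\<close> is \<open>d x / real m\<close>, which is the source of
    \<open>real m ^ 2\<close>.\<close>
  have pt: "esqrt (ennreal (g x)) \<le> esqrt (A x) + (ennreal \<epsilon> + ennreal (1 / (real m ^ 2 * \<epsilon> ^ 3)) * ennreal ((d x)\<^sup>2))" for x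
  proof -
    define a where "a = (\<Sum>j<m. f x (y j)) / real m"
    have a0: "0 \<le> a" by (simp add: a_def f0 sum_nonneg)
    have g0: "0 \<le> g x" by (simp add: g_def f0)
    have "A x = ennreal a"
      unfolding A_def avg using f0
      by (simp add: ennreal_mult[symmetric] sum_ennreal a_def sum_divide_distrib)
    moreover have "a - g x = d x / real m"
      using m0 by (simp add: d_def a_def sum_subtractf diff_divide_distrib)
    then have "sqrt (g x) \<le> sqrt a + (\<epsilon> + 1 / (real m ^ 2 * \<epsilon> ^ 3) * (d x)\<^sup>2)"
      using sqrt_le_add_quartic[OF g0 a0 \<epsilon>] by (simp add: power_divide)
    ultimately show ?thesis
      using g0 a0 \<epsilon> by (simp add: esqrt_ennreal ennreal_mult[symmetric] ennreal_plus[symmetric] del: ennreal_plus)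
  qed
  have "(\<integral>\<^sup>+x. esqrt (ennreal (g x)) \<partial>M) \<le>
    (\<integral>\<^sup>+x. esqrt (A x) + (ennreal \<epsilon> + ennreal (1 / (real m ^ 2 * \<epsilon> ^ 3)) * ennreal ((d x)\<^sup>2)) \<partial>M)"
    by (intro nn_integral_mono pt)
  also have "\<dots> = (\<integral>\<^sup>+x. esqrt (A x) \<partial>M) +
    (ennreal (\<epsilon> * c) + ennreal (1 / (real m ^ 2 * \<epsilon> ^ 3)) * (\<integral>\<^sup>+x. ennreal ((d x)\<^sup>2) \<partial>M))"
    using \<epsilon> by (simp add: nn_integral_add nn_integral_cmult c_def M.emeasure_eq_measure ennreal_mult)
  also have "\<dots> \<le> \<rho> + (ennreal (\<epsilon> * c) + ennreal (1 / (real m ^ 2 * \<epsilon> ^ 3)) * ennreal (real m * (K\<^sup>2 * c)))"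
    using H[OF S] L2 unfolding A_def d_def
    by (intro add_mono mult_left_mono) auto
  also have "ennreal (\<epsilon> * c) + ennreal (1 / (real m ^ 2 * \<epsilon> ^ 3)) * ennreal (real m * (K\<^sup>2 * c))
     = ennreal (\<epsilon> * c + K\<^sup>2 * c / (real m * \<epsilon> ^ 3))"
  proof -
    have "1 / (real m ^ 2 * \<epsilon> ^ 3) * (real m * (K\<^sup>2 * c)) = K\<^sup>2 * c / (real m * \<epsilon> ^ 3)"
      using m0 by (simp add: power2_eq_square)
    moreover have "0 \<le> K\<^sup>2 * c / (real m * \<epsilon> ^ 3)" using \<epsilon> c by simp
    ultimately show ?thesis
      using \<epsilon> c by (simp add: ennreal_mult[symmetric] del: times_divide_eq_left)
  qed
  also have "\<rho> + ennreal (\<epsilon> * c + K\<^sup>2 * c / (real m * \<epsilon> ^ 3)) \<le> \<rho> + ennreal e"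
    using \<epsilon>c me by (intro add_left_mono ennreal_leI) linarith
  finally show "(\<integral>\<^sup>+x. esqrt (ennreal (\<integral>P. f x P \<partial>N)) \<partial>M) \<le> \<rho> + ennreal e"
    unfolding g_def .
qed

text \<open>Truncating \<open>f\<close> at \<open>k\<close> gives the bounded case, and
  \<open>H\<close> survives because truncation only lowers the sums. Monotone convergence in
  \<open>k\<close>, once inside and once outside the square root, removes the truncation.\<close>

lemma nn_integral_esqrt_mixture_le:
  fixes f :: "'a \<Rightarrow> 'b \<Rightarrow> ennreal"
  assumes M: "finite_measure M" and N: "prob_space N"
    and f [measurable]: "(\<lambda>(x, P). f x P) \<in> borel_measurable (M \<Otimes>\<^sub>M N)"
    and V: "V \<subseteq> space N" "AE P in N. P \<in> V"
    and H: "\<And>S w. finite S \<Longrightarrow> S \<subseteq> V \<Longrightarrow> \<forall>P\<in>S. 0 \<le> w P \<Longrightarrow> (\<Sum>P\<in>S. w P) = (1::real) \<Longrightarrow>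
      (\<integral>\<^sup>+x. esqrt (\<Sum>P\<in>S. ennreal (w P) * f x P) \<partial>M) \<le> \<rho>"
  shows "(\<integral>\<^sup>+x. esqrt (\<integral>\<^sup>+P. f x P \<partial>N) \<partial>M) \<le> \<rho>"
proof -
  interpret M: finite_measure M by fact
  interpret N: prob_space N by fact
  interpret pair_sigma_finite M N ..
  have fP [measurable]: "f x \<in> borel_measurable N" if "x \<in> space M" for x
    using measurable_compose[OF measurable_Pair1'[OF that] f] by simp
  define h where "h k x P = min (f x P) (ennreal (real k))" for k x P
  have h [measurable]: "(\<lambda>(x, P). h k x P) \<in> borel_measurable (M \<Otimes>\<^sub>M N)" for k
    unfolding h_def by measurable
  have hP [measurable]: "h k x \<in> borel_measurable N" if "x \<in> space M" for x k
    using measurable_compose[OF measurable_Pair1'[OF that] h] by simp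
  have hreal: "ennreal (enn2real (h k x P)) = h k x P" for k x P
    by (auto simp: h_def min_less_iff_disj)
  have bound: "(\<integral>\<^sup>+x. esqrt (\<integral>\<^sup>+P. h k x P \<partial>N) \<partial>M) \<le> \<rho>" for k
  proof -
    have "(\<integral>\<^sup>+x. esqrt (\<integral>\<^sup>+P. h k x P \<partial>N) \<partial>M) = (\<integral>\<^sup>+x. esqrt (ennreal (\<integral>P. enn2real (h k x P) \<partial>N)) \<partial>M)"
    proof (rule nn_integral_cong)
      fix x assume [simp, measurable]: "x \<in> space M"
      have "integrable N (\<lambda>P. enn2real (h k x P))"
        by (intro N.integrable_const_bound[where B="real k"])
           (auto simp: h_def enn2real_leI)
      then have "(\<integral>\<^sup>+P. ennreal (enn2real (h k x P)) \<partial>N) = ennreal (\<integral>P. enn2real (h k x P) \<partial>N)"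
        by (intro nn_integral_eq_integral) auto
      then show "esqrt (\<integral>\<^sup>+P. h k x P \<partial>N) = esqrt (ennreal (\<integral>P. enn2real (h k x P) \<partial>N))"
        by (simp add: hreal)
    qed
    also have "\<dots> \<le> \<rho>"
    proof (rule nn_integral_esqrt_bounded_mixture_le[OF M N _ _ _ V, where K="real k"])
      show "enn2real (h k x P) \<le> real k" for x P
        by (simp add: h_def enn2real_leI)
      fix S w assume S: "finite S" "S \<subseteq> V" "\<forall>P\<in>S. 0 \<le> w P" "(\<Sum>P\<in>S. w P) = (1::real)"
      have "(\<integral>\<^sup>+x. esqrt (\<Sum>P\<in>S. ennreal (w P) * h k x P) \<partial>M) \<le> (\<integral>\<^sup>+x. esqrt (\<Sum>P\<in>S. ennreal (w P) * f x P) \<partial>M)"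
        by (intro nn_integral_mono esqrt_mono sum_mono mult_left_mono) (auto simp: h_def)
      also have "\<dots> \<le> \<rho>" by (rule H[OF S])
      finally show "(\<integral>\<^sup>+x. esqrt (\<Sum>P\<in>S. ennreal (w P) * ennreal (enn2real (h k x P))) \<partial>M) \<le> \<rho>"
        by (simp add: hreal)
    qed (auto, measurable)
    finally show ?thesis .
  qed
  have inc: "incseq (\<lambda>k. h k x)" for x
    unfolding h_def by (intro incseq_SucI le_funI min.mono ennreal_leI) auto
  have SUP: "(SUP k. h k x P) = f x P" for x P
  proof (cases "f x P" rule: ennreal_cases)
    case (real r)
    obtain k where "r \<le> real k" using real_arch_simple by blast
    then have "h k x P = f x P" using real by (simp add: h_def min_absorb1)
    moreover have "h j x P \<le> f x P" for j by (simp add: h_def)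
    ultimately show ?thesis by (intro antisym SUP_least) (metis SUP_upper UNIV_I)+
  next
    case top
    then show ?thesis by (simp add: h_def ennreal_SUP_of_nat_eq_top flip: ennreal_of_nat_eq_real_of_nat)
  qed
  have "(\<integral>\<^sup>+x. esqrt (\<integral>\<^sup>+P. f x P \<partial>N) \<partial>M) \<le> (\<integral>\<^sup>+x. (SUP k. esqrt (\<integral>\<^sup>+P. h k x P \<partial>N)) \<partial>M)"
  proof (rule nn_integral_mono)
    fix x assume x: "x \<in> space M"
    have "(\<integral>\<^sup>+P. f x P \<partial>N) = (SUP k. \<integral>\<^sup>+P. h k x P \<partial>N)"
      unfolding SUP[symmetric] using inc x by (intro nn_integral_monotone_convergence_SUP) auto
    then show "esqrt (\<integral>\<^sup>+P. f x P \<partial>N) \<le> (SUP k. esqrt (\<integral>\<^sup>+P. h k x P \<partial>N))"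
      by (simp add: esqrt_SUP)
  qed
  also have "\<dots> = (SUP k. \<integral>\<^sup>+x. esqrt (\<integral>\<^sup>+P. h k x P \<partial>N) \<partial>M)"
    using inc by (intro nn_integral_monotone_convergence_SUP)
      (auto simp: incseq_def le_fun_def intro!: esqrt_mono nn_integral_mono)
  also have "\<dots> \<le> \<rho>" by (intro SUP_least bound)
  finally show ?thesis .
qed

section \<open>Reweighted mixtures and products of likelihood ratios\<close>

text \<open>Divided by its total mass \<open>G\<close>, the weight \<open>g\<close> turns
  \<open>N\<close> into a probability measure carried by \<open>V\<close>, to which the unweighted
  bound applies; multiplicativity of the square root lets \<open>esqrt G\<close> factor out.\<close>

lemma nn_integral_esqrt_weighted_mixture_le:
  fixes f :: "'a \<Rightarrow> 'b \<Rightarrow> ennreal"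
  assumes M: "finite_measure M" and N: "finite_measure N"
    and f [measurable]: "(\<lambda>(x, P). f x P) \<in> borel_measurable (M \<Otimes>\<^sub>M N)"
    and g [measurable]: "g \<in> borel_measurable N" and gV: "\<And>P. g P \<noteq> 0 \<Longrightarrow> P \<in> V" and V: "V \<subseteq> space N"
    and \<rho>: "0 < \<rho>"
    and H: "\<And>S w. finite S \<Longrightarrow> S \<subseteq> V \<Longrightarrow> \<forall>P\<in>S. 0 \<le> w P \<Longrightarrow> (\<Sum>P\<in>S. w P) = (1::real) \<Longrightarrow>
      (\<integral>\<^sup>+x. esqrt (\<Sum>P\<in>S. ennreal (w P) * f x P) \<partial>M) \<le> \<rho>"
  shows "(\<integral>\<^sup>+x. esqrt (\<integral>\<^sup>+P. g P * f x P \<partial>N) \<partial>M) \<le> \<rho> * esqrt (\<integral>\<^sup>+P. g P \<partial>N)"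
proof -
  define G where "G = (\<integral>\<^sup>+P. g P \<partial>N)"
  interpret M: finite_measure M by fact
  interpret N: finite_measure N by fact
  interpret pair_sigma_finite M N ..
  have fP [measurable]: "f x \<in> borel_measurable N" if "x \<in> space M" for x
    using measurable_compose[OF measurable_Pair1'[OF that] f] by simp
  consider "G = 0" | "G = \<infinity>" | "G \<noteq> 0" "G \<noteq> \<infinity>" by blast
  then have "(\<integral>\<^sup>+x. esqrt (\<integral>\<^sup>+P. g P * f x P \<partial>N) \<partial>M) \<le> \<rho> * esqrt G"
  proof cases
    case 1
    then have "AE P in N. g P = 0" by (simp add: G_def nn_integral_0_iff_AE)
    then have "(\<integral>\<^sup>+P. g P * f x P \<partial>N) = 0" for x
      by (subst nn_integral_cong_AE[where v="\<lambda>_. 0"]) auto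
    then show ?thesis by simp
  next
    \<comment> \<open>Here \<open>0 < \<rho>\<close> matters: it makes the right-hand side
      infinite.\<close>
    case 2
    then show ?thesis using \<rho> by (simp add: ennreal_mult_top)
  next
    case 3
    define N' where "N' = density N (\<lambda>P. g P / G)"
    have N': "prob_space N'"
    proof
      have "emeasure N' (space N') = (\<integral>\<^sup>+P. g P / G \<partial>N)"
        by (auto simp: N'_def emeasure_density intro!: nn_integral_cong)
      then show "emeasure N' (space N') = 1"
        using 3 by (simp add: nn_integral_divide G_def[symmetric] ennreal_divide_self top.not_eq_extremum)
    qed
    have sets: "sets N' = sets N" by (simp add: N'_def)
    have eq: "(\<integral>\<^sup>+P. g P * f x P \<partial>N) = G * (\<integral>\<^sup>+P. f x P \<partial>N')" if "x \<in> space M" for x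
    proof -
      have "G * (\<integral>\<^sup>+P. f x P \<partial>N') = (\<integral>\<^sup>+P. G * (g P / G * f x P) \<partial>N)"
        unfolding N'_def using that
        by (subst nn_integral_density) (auto simp: nn_integral_cmult)
      also have "\<dots> = (\<integral>\<^sup>+P. g P * f x P \<partial>N)"
      proof (rule nn_integral_cong)
        fix P
        have "G * (g P / G * f x P) = G / G * g P * f x P"
          by (simp add: divide_ennreal_def mult_ac)
        then show "G * (g P / G * f x P) = g P * f x P"
          using 3 by (simp add: ennreal_divide_self top.not_eq_extremum)
      qed
      finally show ?thesis by simp
    qed
    have "(\<integral>\<^sup>+x. esqrt (\<integral>\<^sup>+P. g P * f x P \<partial>N) \<partial>M) = (\<integral>\<^sup>+x. esqrt G * esqrt (\<integral>\<^sup>+P. f x P \<partial>N') \<partial>M)"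
      by (intro nn_integral_cong) (simp add: eq esqrt_mult)
    also have "\<dots> = esqrt G * (\<integral>\<^sup>+x. esqrt (\<integral>\<^sup>+P. f x P \<partial>N') \<partial>M)"
    proof (rule nn_integral_cmult)
      interpret N': prob_space N' by fact
      have [measurable]: "(\<lambda>(x, P). f x P) \<in> borel_measurable (M \<Otimes>\<^sub>M N')"
        using f by (simp add: sets cong: measurable_cong_sets)
      show "(\<lambda>x. esqrt (\<integral>\<^sup>+P. f x P \<partial>N')) \<in> borel_measurable M" by measurable
    qed
    also have "\<dots> \<le> esqrt G * \<rho>"
    proof (intro mult_left_mono nn_integral_esqrt_mixture_le[OF M N'] H)
      show "(\<lambda>(x, P). f x P) \<in> borel_measurable (M \<Otimes>\<^sub>M N')"
        using f by (simp add: sets cong: measurable_cong_sets)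
      show "V \<subseteq> space N'" using V by (simp add: N'_def)
      show "AE P in N'. P \<in> V"
        unfolding N'_def using gV by (subst AE_density) (auto simp: zero_less_iff_neq_zero)
    qed auto
    finally show ?thesis by (simp add: mult.commute)
  qed
  then show ?thesis by (simp add: G_def)
qed

text \<open>A mixture of products is not a product, so the coordinates do not separate. Instead the
  last one is integrated first: the likelihood of the earlier ones, restricted to \<open>V\<close>,
  serves as the weight \<open>g\<close> of the preceding lemma, which yields one factor
  \<open>\<rho>\<close> and the same integral for \<open>n\<close>.\<close>

lemma nn_integral_esqrt_product_mixture_le:
  fixes f :: "'a \<Rightarrow> 'b \<Rightarrow> ennreal"
  assumes M: "prob_space M" and N: "finite_measure N"
    and f [measurable]: "(\<lambda>(x, P). f x P) \<in> borel_measurable (M \<Otimes>\<^sub>M N)"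
    and V [measurable]: "V \<in> sets N" and \<rho>: "0 < \<rho>"
    and H: "\<And>S w. finite S \<Longrightarrow> S \<subseteq> V \<Longrightarrow> \<forall>P\<in>S. 0 \<le> w P \<Longrightarrow> (\<Sum>P\<in>S. w P) = (1::real) \<Longrightarrow>
      (\<integral>\<^sup>+x. esqrt (\<Sum>P\<in>S. ennreal (w P) * f x P) \<partial>M) \<le> \<rho>"
  shows "(\<integral>\<^sup>+x. esqrt (\<integral>\<^sup>+P. (\<Prod>i<n. f (x i) P) * indicator V P \<partial>N) \<partial>(Pi\<^sub>M {..<n} (\<lambda>_. M)))
    \<le> \<rho> ^ n * esqrt (emeasure N V)"
proof (induction n)
  case 0
  interpret M: prob_space M by fact
  interpret product_sigma_finite "\<lambda>_::nat. M" ..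
  show ?case by (simp add: PiM_empty nn_integral_count_space_finite)
next
  case (Suc n)
  interpret M: prob_space M by fact
  interpret N: finite_measure N by fact
  interpret product_sigma_finite "\<lambda>_::nat. M" ..
  define F where "F n x = (\<integral>\<^sup>+P. (\<Prod>i<n. f (x i) P) * indicator V P \<partial>N)" for n :: nat and x
  have F [measurable]: "F n \<in> borel_measurable (Pi\<^sub>M {..<n} (\<lambda>_. M))" for n
    unfolding F_def by measurable
  have "(\<integral>\<^sup>+x. esqrt (F (Suc n) x) \<partial>(Pi\<^sub>M {..<Suc n} (\<lambda>_. M))) =
    (\<integral>\<^sup>+x. \<integral>\<^sup>+y. esqrt (F (Suc n) (x(n := y))) \<partial>M \<partial>(Pi\<^sub>M {..<n} (\<lambda>_. M)))"
    using F[of "Suc n"] unfolding lessThan_Suc by (intro product_nn_integral_insert) auto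
  also have "\<dots> \<le> (\<integral>\<^sup>+x. \<rho> * esqrt (F n x) \<partial>(Pi\<^sub>M {..<n} (\<lambda>_. M)))"
  proof (rule nn_integral_mono)
    fix x assume x: "x \<in> space (Pi\<^sub>M {..<n} (\<lambda>_. M))"
    have [measurable]: "(\<lambda>P. f (x i) P) \<in> borel_measurable N" if "i < n" for i
      using x that measurable_compose[OF measurable_Pair1' f] by (auto simp: space_PiM PiE_def Pi_def)
    have "F (Suc n) (x(n := y)) = (\<integral>\<^sup>+P. ((\<Prod>i<n. f (x i) P) * indicator V P) * f y P \<partial>N)" for y
      by (simp add: F_def mult_ac)
    moreover have "(\<integral>\<^sup>+y. esqrt (\<integral>\<^sup>+P. ((\<Prod>i<n. f (x i) P) * indicator V P) * f y P \<partial>N) \<partial>M)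
      \<le> \<rho> * esqrt (\<integral>\<^sup>+P. (\<Prod>i<n. f (x i) P) * indicator V P \<partial>N)"
      by (rule nn_integral_esqrt_weighted_mixture_le[OF M.finite_measure_axioms N f _ _ _ \<rho> H])
         (auto simp: indicator_def sets.sets_into_space[OF V] split: if_splits
           intro!: borel_measurable_times_ennreal borel_measurable_prod_ennreal)
    ultimately show "(\<integral>\<^sup>+y. esqrt (F (Suc n) (x(n := y))) \<partial>M) \<le> \<rho> * esqrt (F n x)"
      by (simp add: F_def)
  qed
  also have "\<dots> = \<rho> * (\<integral>\<^sup>+x. esqrt (F n x) \<partial>(Pi\<^sub>M {..<n} (\<lambda>_. M)))"
    by (rule nn_integral_cmult) measurable
  also have "\<dots> \<le> \<rho> * (\<rho> ^ n * esqrt (emeasure N V))"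
    using Suc unfolding F_def by (intro mult_left_mono) auto
  finally show ?case by (simp add: F_def mult.assoc)
qed

section \<open>Jensen's inequality for the denominator\<close>

text \<open>Jensen's inequality for \<open>y powr (-1/2)\<close> under \<open>N\<close> normalised
  to \<open>B\<close>, obtained by integrating the tangent line at the mean. The exponent
  \<open>-3/2\<close> combines \<open>-1/2\<close> from undoing the normalisation in the mean and
  \<open>-1\<close> from normalising the integral on the right.\<close>

lemma esqrt_inverse_integral_le:
  assumes N: "finite_measure N" and B: "B \<in> sets N" "emeasure N B \<noteq> 0"
    and q [measurable]: "q \<in> borel_measurable N"
  shows "esqrt (inverse (\<integral>\<^sup>+Q\<in>B. q Q \<partial>N)) \<le>
    ennreal (measure N B powr (-3/2)) * (\<integral>\<^sup>+Q\<in>B. esqrt (inverse (q Q)) \<partial>N)"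
proof -
  interpret N: finite_measure N by fact
  note B(1) [measurable]
  define b where "b = measure N B"
  have b: "0 < b" and eb: "emeasure N B = ennreal b"
    using B by (auto simp: b_def N.emeasure_eq_measure zero_less_measure_iff)
  define D where "D = (\<integral>\<^sup>+Q\<in>B. q Q \<partial>N)"
  define I where "I = (\<integral>\<^sup>+Q\<in>B. esqrt (inverse (q Q)) \<partial>N)"
  have "esqrt (inverse D) \<le> ennreal (b powr (-3/2)) * I"
  proof (cases D rule: ennreal_cases)
    case (real d)
    show ?thesis
    proof (cases "d = 0")
      \<comment> \<open>\<open>D = 0\<close> forces \<open>q = 0\<close> almost everywhere on
        \<open>B\<close>, where the inverse is infinite; as \<open>B\<close> has positive mass, the
        right-hand side is infinite.\<close>
      case True
      then have "AE Q in N. q Q * indicator B Q = 0"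
        using real by (subst (asm) D_def) (simp add: nn_integral_0_iff_AE)
      then have "I = (\<integral>\<^sup>+Q\<in>B. top \<partial>N)"
        unfolding I_def by (intro nn_integral_cong_AE) (auto split: split_indicator)
      also have "\<dots> = top * emeasure N B"
        by (rule nn_integral_cmult_indicator) measurable
      finally have "I = top"
        using b by (simp add: eb ennreal_top_mult)
      then show ?thesis using b by (simp add: ennreal_mult_top)
    next
      case False
      \<comment> \<open>The mean of \<open>q\<close> over \<open>B\<close>, at which the tangent is
        taken.\<close>
      define t where "t = d / b"
      have d: "0 < d" using False real by simp
      then have t: "0 < t" using b by (simp add: t_def)
      \<comment> \<open>the tangent line of \<open>y powr (-1/2)\<close> at \<open>t\<close>, moved so that no subtraction occurs\<close>
      have tangent: "ennreal (3 / 2 * t powr (-1/2)) \<le> esqrt (inverse y) + ennreal (t powr (-3/2) / 2) * y" for y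
      proof (cases y rule: ennreal_cases)
        case y: (real r)
        show ?thesis
        proof (cases "r = 0")
          case False
          then have r: "0 < r" using y by simp
          define u where "u = sqrt r"
          define v where "v = sqrt t"
          have u: "0 < u" and v: "0 < v" using r t by (auto simp: u_def v_def)
          \<comment> \<open>The tangent inequality multiplied by \<open>2 * u * v ^ 3\<close>; the
            difference of the two sides factors with a double zero at \<open>u = v\<close>, the
            point of tangency.\<close>
          have "3 * (u * v\<^sup>2) \<le> 2 * v ^ 3 + u ^ 3"
          proof -
            have "0 \<le> (u - v)\<^sup>2 * (u + 2 * v)" using u v by simp
            also have "\<dots> = 2 * v ^ 3 + u ^ 3 - 3 * (u * v\<^sup>2)"
              by (simp add: power2_eq_square power3_eq_cube algebra_simps)
            finally show ?thesis by simp
          qed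
          then have "3 / 2 * (1 / v) \<le> 1 / u + 1 / v ^ 3 / 2 * u\<^sup>2"
            using u v by (simp add: field_simps power2_eq_square power3_eq_cube)
          moreover have "t powr (-1/2) = 1 / v" "t powr (-3/2) = 1 / v ^ 3"
          proof -
            have *: "t powr (1/2) = v" using t by (simp add: v_def powr_half_sqrt)
            show "t powr (-1/2) = 1 / v" using * by (simp add: powr_minus_divide)
            have "t powr (3/2) = v powr 3" unfolding *[symmetric] by (simp add: powr_powr)
            then have "t powr (3/2) = v ^ 3" using v by (simp add: powr_numeral)
            then show "t powr (-3/2) = 1 / v ^ 3" by (simp add: powr_minus_divide)
          qed
          moreover have "esqrt (inverse y) = ennreal (1 / u)"
            using r y by (simp add: inverse_ennreal esqrt_ennreal u_def real_sqrt_inverse inverse_eq_divide real_sqrt_divide)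
          moreover have "y = ennreal (u\<^sup>2)" using r y by (simp add: u_def)
          ultimately show ?thesis
            using u v by (simp add: ennreal_mult[symmetric] ennreal_plus[symmetric] del: ennreal_plus)
        qed (use y in simp)
      qed (use t in \<open>simp add: ennreal_mult_top\<close>)
      \<comment> \<open>Integrated over \<open>B\<close>, the linear term contributes exactly a
        third of the left-hand side because \<open>D = t * b\<close>; cancelling it leaves a lower
        bound for \<open>I\<close>.\<close>
      have "ennreal (3 / 2 * t powr (-1/2) * b) = (\<integral>\<^sup>+Q\<in>B. ennreal (3 / 2 * t powr (-1/2)) \<partial>N)"
        using b by (simp add: nn_integral_cmult_indicator eb ennreal_mult[symmetric])
      also have "\<dots> \<le> (\<integral>\<^sup>+Q. esqrt (inverse (q Q)) * indicator B Q + ennreal (t powr (-3/2) / 2) * (q Q * indicator B Q) \<partial>N)"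
        using tangent by (intro nn_integral_mono) (auto split: split_indicator)
      also have "\<dots> = I + ennreal (t powr (-3/2) / 2) * D"
        by (simp add: nn_integral_add nn_integral_cmult I_def D_def)
      also have "ennreal (t powr (-3/2) / 2) * D = ennreal (1 / 2 * t powr (-1/2) * b)"
      proof -
        have "t powr (-3/2) * d = t powr (-3/2) * t powr 1 * b"
          using d b by (simp add: t_def)
        also have "\<dots> = t powr (-1/2) * b"
          by (subst powr_add[symmetric]) simp
        finally show ?thesis using real b by (simp add: ennreal_mult[symmetric])
      qed
      finally have le: "ennreal (3 / 2 * t powr (-1/2) * b) \<le> I + ennreal (1 / 2 * t powr (-1/2) * b)" .
      have I: "ennreal (t powr (-1/2) * b) \<le> I"
      proof (cases I rule: ennreal_cases)
        case (real i)
        with le b have "3 / 2 * t powr (-1/2) * b \<le> i + 1 / 2 * t powr (-1/2) * b"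
          by (simp add: ennreal_plus[symmetric] del: ennreal_plus)
        then show ?thesis using real by (simp add: ennreal_leI mult.commute)
      qed simp
      have "esqrt (inverse D) = ennreal (d powr (-1/2))"
        using False real by (simp add: inverse_ennreal esqrt_ennreal powr_minus powr_half_sqrt real_sqrt_inverse)
      also have "d powr (-1/2) = b powr (-3/2) * (t powr (-1/2) * b)"
      proof -
        have "d powr (-1/2) = (t * b) powr (-1/2)" using b by (simp add: t_def)
        also have "\<dots> = t powr (-1/2) * b powr (-3/2 + 1)" using t b by (simp add: powr_mult)
        also have "b powr (-3/2 + 1) = b powr (-3/2) * b" using b by (subst powr_add) simp
        finally show ?thesis by (simp add: mult_ac)
      qed
      also have "ennreal (b powr (-3/2) * (t powr (-1/2) * b)) \<le> ennreal (b powr (-3/2)) * I"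
        using I b by (simp add: ennreal_mult mult_left_mono)
      finally show ?thesis .
    qed
  qed simp
  then show ?thesis by (simp add: D_def I_def b_def)
qed

section \<open>Inverses, quotients and series of extended nonnegative reals\<close>

lemma ennreal_inverse_antimono: "a \<le> b \<Longrightarrow> inverse b \<le> inverse (a::ennreal)"
proof (cases a b rule: ennreal2_cases)
  case (real_real r s)
  moreover assume "a \<le> b"
  ultimately show ?thesis
    by (cases "r = 0") (auto simp: inverse_ennreal le_imp_inverse_le intro!: ennreal_leI)
qed (auto simp: top_unique)

text \<open>Finiteness of the factors excludes \<open>0 * top\<close>, where the left-hand side
  would be \<open>inverse 0 = top\<close> and the right-hand side
  \<open>top * 0 = 0\<close>.\<close>

lemma ennreal_inverse_prod:
  fixes f :: "'i \<Rightarrow> ennreal"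
  assumes "finite A" "\<And>i. i \<in> A \<Longrightarrow> f i \<noteq> top"
  shows "inverse (\<Prod>i\<in>A. f i) = (\<Prod>i\<in>A. inverse (f i))"
proof -
  from assms have "(\<Prod>i\<in>A. f i) \<noteq> top \<and> inverse (\<Prod>i\<in>A. f i) = (\<Prod>i\<in>A. inverse (f i))"
    by (induction A rule: finite_induct)
       (auto simp: ennreal_mult_eq_top_iff ennreal_inverse_mult top.not_eq_extremum)
  then show ?thesis ..
qed

lemma ennreal_divide_le_1: "a \<le> b \<Longrightarrow> a / b \<le> (1::ennreal)"
  by (cases "b = 0") (auto intro!: divide_le_posI_ennreal simp: zero_less_iff_neq_zero)

lemma tendsto_0_of_suminf_ennreal:
  fixes f :: "nat \<Rightarrow> ennreal"
  assumes "(\<Sum>n. f n) \<noteq> top"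
  shows "f \<longlonglongrightarrow> 0"
proof -
  have "f n \<noteq> top" for n
    using assms ennreal_suminf_lessD[of f top n] by (simp add: top.not_eq_extremum)
  then have eq: "f n = ennreal (enn2real (f n))" for n by (simp add: top.not_eq_extremum)
  have "summable (\<lambda>n. enn2real (f n))"
    by (rule summable_suminf_not_top) (use assms in \<open>auto simp: eq[symmetric]\<close>)
  from tendsto_ennrealI[OF summable_LIMSEQ_zero[OF this]] show ?thesis
    by (simp add: eq[symmetric])
qed

lemma emeasure_PiM_singleton_power:
  assumes "prob_space P" "A \<in> sets P"
  shows "emeasure (Pi\<^sub>M {..<n} (\<lambda>_::nat. P)) (Pi\<^sub>E {..<n} (\<lambda>_. A)) = emeasure P A ^ n"
proof -
  interpret prob_space P by fact
  interpret finite_product_prob_space "\<lambda>_::nat. P" "{..<n}" by standard auto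
  show ?thesis using assms by (subst emeasure_PiM) auto
qed

section \<open>Densities of the model and of \<open>P0\<close>\<close>

context dominated_model
begin

text \<open>A \<open>mu\<close>-null set is null for every \<open>P\<close> in the model, hence for
  their mixture, the predictive distribution of one observation, and so for \<open>P0\<close>.
  Statements about densities that hold \<open>mu\<close>-almost everywhere thereby transfer to
  \<open>P0\<close>.\<close>

lemma absolutely_continuous_if_predictive:
  assumes P0: "prob_space P0" "sets P0 = sets mu"
    and ac: "absolutely_continuous (prior_predictive mu prior 1) (Pi\<^sub>M {..<1} (\<lambda>_. P0))"
  shows "absolutely_continuous mu P0"
  unfolding absolutely_continuous_def
proof
  fix A assume A: "A \<in> null_sets mu"
  let ?E = "Pi\<^sub>E {..<1::nat} (\<lambda>_. A)"
  have E: "?E \<in> sets (Pi\<^sub>M {..<1} (\<lambda>_. mu))"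
    using A by (intro sets_PiM_I_finite) auto
  have "emeasure (Pi\<^sub>M {..<1} (\<lambda>_. P)) ?E = 0" if P: "P \<in> space prior" for P
  proof -
    have "emeasure P A = emeasure (density mu (p P)) A" using density_model[OF P] by simp
    also have "\<dots> = 0"
      using A
      by (intro null_setsD1 absolutely_continuousI_density[unfolded absolutely_continuous_def, THEN subsetD])
        (auto intro!: measurable_compose[OF measurable_Pair2'[OF P] measurable_density_model, simplified])
    finally have "emeasure P A = 0" .
    then show ?thesis
      using A sets_model[OF P] by (subst emeasure_PiM_singleton_power[OF prob_space_model[OF P]]) auto
  qed
  then have "emeasure (prior_predictive mu prior 1) ?E = 0"
    using E by (subst emeasure_prior_predictive) (auto simp: nn_integral_0_iff_AE cong: nn_integral_cong)
  then have "?E \<in> null_sets (prior_predictive mu prior 1)"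
    using E by (auto simp: null_sets_def sets_prior_predictive)
  then have "emeasure (Pi\<^sub>M {..<1} (\<lambda>_. P0)) ?E = 0"
    using ac by (auto simp: absolutely_continuous_def)
  then show "A \<in> null_sets P0"
    using A P0 by (subst (asm) emeasure_PiM_singleton_power[OF P0(1)]) auto
qed

lemma borel_measurable_density [measurable]: "P \<in> space prior \<Longrightarrow> p P \<in> borel_measurable mu"
  using measurable_compose[OF measurable_Pair2' measurable_density_model] by simp

text \<open>Each density has integral one, so it is finite \<open>mu\<close>-almost everywhere;
  Fubini exchanges the two almost-everywhere quantifiers. Later this makes the inverse likelihood a
  product of inverses.\<close>

lemma AE_density_finite:
  assumes P0: "sets P0 = sets mu" and ac: "absolutely_continuous mu P0"
  shows "AE x in P0. AE P in prior. p P x \<noteq> top"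
proof (rule absolutely_continuous_AE[OF P0 ac])
  interpret pair_sigma_finite mu prior ..
  have [measurable]: "(\<lambda>x. p (snd x) (fst x)) \<in> borel_measurable (mu \<Otimes>\<^sub>M prior)"
    using measurable_density_model by (simp add: case_prod_beta')
  have "AE P in prior. AE x in mu. p P x \<noteq> top"
  proof (rule AE_I2)
    fix P assume P: "P \<in> space prior"
    then interpret P: prob_space P by (rule prob_space_model)
    have "(\<integral>\<^sup>+x. p P x \<partial>mu) = emeasure (density mu (p P)) (space mu)"
      using P by (auto simp: emeasure_density intro!: nn_integral_cong)
    also have "\<dots> = 1"
      using P.emeasure_space_1 density_model[OF P] sets_eq_imp_space_eq[OF sets_model[OF P]] by simp
    finally show "AE x in mu. p P x \<noteq> top"
      using nn_integral_PInf_AE[of "p P" mu] P by simp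
  qed
  then show "AE x in mu. AE P in prior. p P x \<noteq> top"
    by (subst AE_commute) auto
qed

text \<open>The witness is the measure with density \<open>r\<close>, the same combination of the
  chosen densities \<open>p P\<close>. Both \<open>r\<close> and \<open>p Q\<close> agree
  \<open>mu\<close>-almost everywhere, hence \<open>P0\<close>-almost everywhere, with the
  Radon-Nikodym derivatives in \<open>ratio_moment\<close>.\<close>

lemma nn_integral_esqrt_convex_combination:
  assumes P0: "sets P0 = sets mu" and ac: "absolutely_continuous mu P0"
    and Q: "Q \<in> space prior" and S: "finite S" "S \<subseteq> V" "\<forall>P\<in>S. 0 \<le> w P" "(\<Sum>P\<in>S. w P) = (1::real)"
    and V: "V \<subseteq> space prior"
  shows "\<exists>R\<in>convex_hull_measures V.
    (\<integral>\<^sup>+x. esqrt (\<Sum>P\<in>S. ennreal (w P) * (p P x * inverse (p Q x))) \<partial>P0) = ratio_moment mu P0 R Q (1/2)"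
proof
  define r where "r x = (\<Sum>P\<in>S. ennreal (w P) * p P x)" for x
  have SM: "P \<in> space prior" if "P \<in> S" for P using that S V by auto
  have r [measurable]: "r \<in> borel_measurable mu"
    unfolding r_def using SM by (intro borel_measurable_sum) auto
  let ?R = "density mu r"
  show "?R \<in> convex_hull_measures V"
    unfolding convex_hull_measures_def
  proof (intro CollectI exI conjI ballI)
    fix A assume "A \<in> sets ?R"
    then have A [measurable]: "A \<in> sets mu" by simp
    have "emeasure ?R A = (\<integral>\<^sup>+x. (\<Sum>P\<in>S. ennreal (w P) * (p P x * indicator A x)) \<partial>mu)"
      by (simp add: emeasure_density r_def sum_distrib_right mult.assoc)
    also have "\<dots> = (\<Sum>P\<in>S. ennreal (w P) * (\<integral>\<^sup>+x. p P x * indicator A x \<partial>mu))"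
      using SM by (simp add: nn_integral_sum nn_integral_cmult)
    also have "\<dots> = (\<Sum>P\<in>S. ennreal (w P) * emeasure P A)"
    proof (intro sum.cong refl arg_cong2[where f="(*)"])
      fix P assume "P \<in> S"
      then have "emeasure P A = emeasure (density mu (p P)) A" using density_model[OF SM] by simp
      then show "(\<integral>\<^sup>+x. p P x * indicator A x \<partial>mu) = emeasure P A"
        using SM[OF \<open>P \<in> S\<close>] by (simp add: emeasure_density)
    qed
    finally show "emeasure ?R A = (\<Sum>P\<in>S. ennreal (w P) * emeasure P A)" .
  qed (use S SM sets_model in auto)
  have "AE x in mu. r x = RN_deriv mu ?R x"
    by (rule dominating.RN_deriv_unique) auto
  then have rR: "AE x in P0. r x = RN_deriv mu ?R x"
    by (rule absolutely_continuous_AE[OF P0 ac])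
  have "AE x in mu. p Q x = RN_deriv mu Q x"
    using Q density_model[OF Q] by (intro dominating.RN_deriv_unique) auto
  then have qQ: "AE x in P0. p Q x = RN_deriv mu Q x"
    by (rule absolutely_continuous_AE[OF P0 ac])
  \<comment> \<open>The restriction to positive densities in \<open>ratio_moment\<close> costs
    nothing: the density of \<open>P0\<close> is positive \<open>P0\<close>-almost everywhere, and
    where \<open>r\<close> vanishes the integrand is \<open>0\<close>, even over a zero
    denominator.\<close>
  have "AE x in density mu (RN_deriv mu P0). 0 < RN_deriv mu P0 x"
    by (subst AE_density) auto
  then have pos: "AE x in P0. 0 < RN_deriv mu P0 x"
    unfolding dominating.density_RN_deriv[OF ac P0] .
  show "(\<integral>\<^sup>+x. esqrt (\<Sum>P\<in>S. ennreal (w P) * (p P x * inverse (p Q x))) \<partial>P0) = ratio_moment mu P0 ?R Q (1/2)"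
    unfolding ratio_moment_def
  proof (intro nn_integral_cong_AE, use rR qQ pos AE_space in eventually_elim)
    case (elim x)
    have "(\<Sum>P\<in>S. ennreal (w P) * (p P x * inverse (p Q x))) = r x / p Q x"
      by (simp add: r_def sum_distrib_right mult.assoc divide_ennreal_def)
    with elim sets_eq_imp_space_eq[OF P0] show ?case
      by (auto simp: indicator_def zero_less_iff_neq_zero)
  qed
qed

lemma measurable_density_pair:
  assumes "sets P0 = sets mu"
  shows "(\<lambda>(x, P). p P x) \<in> borel_measurable (P0 \<Otimes>\<^sub>M prior)"
  using measurable_density_model by (simp add: assms cong: measurable_cong_sets)

lemma borel_measurable_posterior:
  assumes "sets P0 = sets mu" and A [measurable]: "A \<in> sets prior"
  shows "(\<lambda>x. posterior prior p n x A) \<in> borel_measurable (Pi\<^sub>M {..<n} (\<lambda>_. P0))"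
proof -
  note measurable_density_pair[OF assms(1), measurable]
  show ?thesis unfolding posterior_def by measurable
qed

section \<open>The mean of a posterior mass\<close>

text \<open>The bound is claimed for almost every \<open>x\<close> because the values
  \<open>p Q (x i)\<close> must be finite for almost all \<open>Q\<close> before their inverses can
  be moved under the integral over \<open>P\<close>.\<close>

lemma AE_posterior_le:
  assumes P0: "prob_space P0" "sets P0 = sets mu" and ac: "absolutely_continuous mu P0"
    and W: "W \<in> sets prior" and B: "B \<in> sets prior" "measure prior B > 0"
  shows "AE x in Pi\<^sub>M {..<n} (\<lambda>_. P0). posterior prior p n x W \<le> ennreal (measure prior B powr (-3/2)) *
    (\<integral>\<^sup>+Q\<in>B. esqrt (\<integral>\<^sup>+P. (\<Prod>i<n. p P (x i) * inverse (p Q (x i))) * indicator W P \<partial>prior) \<partial>prior)"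
proof -
  note measurable_density_pair[OF P0(2), measurable] W[measurable] B(1)[measurable]
  have fin: "AE x in Pi\<^sub>M {..<n} (\<lambda>_. P0). \<forall>i\<in>{..<n}. AE Q in prior. p Q (x i) \<noteq> top"
    using P0(1) AE_density_finite[OF P0(2) ac] by (intro AE_finite_allI AE_PiM_component) auto
  show ?thesis
    using fin AE_space
  proof eventually_elim
    case (elim x)
    have [measurable]: "(\<lambda>P. p P (x i)) \<in> borel_measurable prior" if "i < n" for i
    proof -
      have "x i \<in> space P0" using elim(2) that by (auto simp: space_PiM PiE_def Pi_def)
      from measurable_compose[OF measurable_Pair1'[OF this] measurable_density_pair[OF P0(2)]]
      show ?thesis by simp
    qed
    define L where "L P = (\<Prod>i<n. p P (x i))" for P
    have L [measurable]: "L \<in> borel_measurable prior"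
      unfolding L_def by (intro borel_measurable_prod_ennreal) auto
    define N where "N = (\<integral>\<^sup>+P\<in>W. L P \<partial>prior)"
    define D where "D = (\<integral>\<^sup>+P. L P \<partial>prior)"
    define DB where "DB = (\<integral>\<^sup>+P\<in>B. L P \<partial>prior)"
    define c where "c = ennreal (measure prior B powr (-3/2))"
    have ND: "N \<le> D" and DBD: "DB \<le> D"
      unfolding N_def D_def DB_def by (auto intro!: nn_integral_mono split: split_indicator)
    have "posterior prior p n x W = N / D"
      by (simp add: posterior_def N_def D_def L_def)
    \<comment> \<open>The quotient is at most one in all cases: \<open>0 / 0\<close> and
      \<open>top / top\<close> are \<open>0\<close> in \<open>ennreal\<close>.\<close>
    also have "\<dots> \<le> esqrt (N / D)"
      by (intro esqrt_ge_self ennreal_divide_le_1 ND)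
    also have "\<dots> = esqrt N * esqrt (inverse D)"
      by (simp add: divide_ennreal_def esqrt_mult)
    also have "\<dots> \<le> esqrt N * esqrt (inverse DB)"
      by (intro mult_left_mono esqrt_mono ennreal_inverse_antimono DBD) simp
    also have "\<dots> \<le> esqrt N * (c * (\<integral>\<^sup>+Q\<in>B. esqrt (inverse (L Q)) \<partial>prior))"
      unfolding DB_def c_def using B
      by (intro mult_left_mono esqrt_inverse_integral_le)
         (auto simp: prior_space.finite_measure_axioms prior_space.emeasure_eq_measure)
    also have "\<dots> = c * (\<integral>\<^sup>+Q. esqrt N * (esqrt (inverse (L Q)) * indicator B Q) \<partial>prior)"
      by (subst nn_integral_cmult) (auto simp: mult.left_commute)
    also have "(\<integral>\<^sup>+Q. esqrt N * (esqrt (inverse (L Q)) * indicator B Q) \<partial>prior) =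
      (\<integral>\<^sup>+Q\<in>B. esqrt (\<integral>\<^sup>+P. (\<Prod>i<n. p P (x i) * inverse (p Q (x i))) * indicator W P \<partial>prior) \<partial>prior)"
    proof (rule nn_integral_cong_AE)
      have "AE Q in prior. \<forall>i\<in>{..<n}. p Q (x i) \<noteq> top"
        using elim(1) by (intro AE_finite_allI) auto
      then show "AE Q in prior. esqrt N * (esqrt (inverse (L Q)) * indicator B Q) =
        esqrt (\<integral>\<^sup>+P. (\<Prod>i<n. p P (x i) * inverse (p Q (x i))) * indicator W P \<partial>prior) * indicator B Q"
      proof eventually_elim
        case (elim Q)
        have inv: "inverse (L Q) = (\<Prod>i<n. inverse (p Q (x i)))"
          unfolding L_def using elim by (intro ennreal_inverse_prod) auto
        have "(\<integral>\<^sup>+P. (\<Prod>i<n. p P (x i) * inverse (p Q (x i))) * indicator W P \<partial>prior) =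
          (\<integral>\<^sup>+P. inverse (L Q) * (L P * indicator W P) \<partial>prior)"
          unfolding inv by (simp add: prod.distrib L_def mult_ac)
        also have "\<dots> = inverse (L Q) * N"
          unfolding N_def by (rule nn_integral_cmult) measurable
        finally show ?case by (simp add: esqrt_mult mult_ac)
      qed
    qed
    finally show ?case by (simp add: c_def)
  qed
qed

text \<open>Fubini brings the integral over the sample inside the one over \<open>Q\<close>. For
  fixed \<open>Q\<close> in \<open>B\<close> the product bound applies to the ratios
  \<open>p P x * inverse (p Q x)\<close>, its one-step hypothesis being \<open>H\<close> for a
  member of the convex hull.\<close>

lemma nn_integral_posterior_le:
  assumes P0: "prob_space P0" "sets P0 = sets mu" and ac: "absolutely_continuous mu P0"
    and W: "W \<in> sets prior" and B: "B \<in> sets prior" "measure prior B > 0" and \<rho>: "0 < \<rho>"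
    and H: "\<And>Q R. Q \<in> B \<Longrightarrow> R \<in> convex_hull_measures W \<Longrightarrow> ratio_moment mu P0 R Q (1/2) \<le> \<rho>"
  shows "(\<integral>\<^sup>+x. posterior prior p n x W \<partial>(Pi\<^sub>M {..<n} (\<lambda>_. P0))) \<le>
    ennreal (measure prior B powr (-1/2)) * \<rho> ^ n * esqrt (emeasure prior W)"
proof -
  note measurable_density_pair[OF P0(2), measurable] W[measurable] B(1)[measurable]
  interpret P0: prob_space P0 by fact
  interpret X: product_prob_space "\<lambda>_::nat. P0" "{..<n}" ..
  interpret X: pair_sigma_finite "Pi\<^sub>M {..<n} (\<lambda>_::nat. P0)" prior ..
  define F where "F x Q = esqrt (\<integral>\<^sup>+P. (\<Prod>i<n. p P (x i) * inverse (p Q (x i))) * indicator W P \<partial>prior)" for x Q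
  have F [measurable]: "(\<lambda>(x, Q). F x Q) \<in> borel_measurable (Pi\<^sub>M {..<n} (\<lambda>_. P0) \<Otimes>\<^sub>M prior)"
    unfolding F_def by measurable
  define b where "b = measure prior B"
  have b: "0 < b" using B by (simp add: b_def)
  have "(\<integral>\<^sup>+x. posterior prior p n x W \<partial>(Pi\<^sub>M {..<n} (\<lambda>_. P0))) \<le>
      (\<integral>\<^sup>+x. ennreal (b powr (-3/2)) * (\<integral>\<^sup>+Q\<in>B. F x Q \<partial>prior) \<partial>(Pi\<^sub>M {..<n} (\<lambda>_. P0)))"
    unfolding F_def b_def by (intro nn_integral_mono_AE AE_posterior_le assms)
  also have "\<dots> = ennreal (b powr (-3/2)) * (\<integral>\<^sup>+x. (\<integral>\<^sup>+Q\<in>B. F x Q \<partial>prior) \<partial>(Pi\<^sub>M {..<n} (\<lambda>_. P0)))"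
    by (rule nn_integral_cmult) measurable
  also have "(\<integral>\<^sup>+x. (\<integral>\<^sup>+Q\<in>B. F x Q \<partial>prior) \<partial>(Pi\<^sub>M {..<n} (\<lambda>_. P0))) =
      (\<integral>\<^sup>+Q. \<integral>\<^sup>+x. F x Q * indicator B Q \<partial>(Pi\<^sub>M {..<n} (\<lambda>_. P0)) \<partial>prior)"
    by (rule X.Fubini'[symmetric]) measurable
  also have "\<dots> \<le> (\<integral>\<^sup>+Q. \<rho> ^ n * esqrt (emeasure prior W) * indicator B Q \<partial>prior)"
  proof (rule nn_integral_mono)
    fix Q assume Q: "Q \<in> space prior"
    show "(\<integral>\<^sup>+x. F x Q * indicator B Q \<partial>(Pi\<^sub>M {..<n} (\<lambda>_. P0))) \<le> \<rho> ^ n * esqrt (emeasure prior W) * indicator B Q"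
    proof (cases "Q \<in> B")
      case True
      have [measurable]: "p Q \<in> borel_measurable P0"
        using Q by (simp add: P0(2) cong: measurable_cong_sets)
      have "(\<integral>\<^sup>+x. F x Q \<partial>(Pi\<^sub>M {..<n} (\<lambda>_. P0))) \<le> \<rho> ^ n * esqrt (emeasure prior W)"
        unfolding F_def
      proof (rule nn_integral_esqrt_product_mixture_le[OF P0(1) prior_space.finite_measure_axioms _ W \<rho>])
        show "(\<lambda>(x, P). p P x * inverse (p Q x)) \<in> borel_measurable (P0 \<Otimes>\<^sub>M prior)"
          by measurable
        show "(\<integral>\<^sup>+x. esqrt (\<Sum>P\<in>S. ennreal (w P) * (p P x * inverse (p Q x))) \<partial>P0) \<le> \<rho>"
          if "finite S" "S \<subseteq> W" "\<forall>P\<in>S. 0 \<le> w P" "(\<Sum>P\<in>S. w P) = (1::real)" for S w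
          using nn_integral_esqrt_convex_combination[OF P0(2) ac Q that sets.sets_into_space[OF W]] H[OF True]
          by auto
      qed
      with True show ?thesis by simp
    qed simp
  qed
  \<comment> \<open>Integration over \<open>B\<close> gives the factor \<open>b\<close>, which
    raises the exponent \<open>-3/2\<close> from Jensen's inequality to \<open>-1/2\<close>.\<close>
  also have "\<dots> = \<rho> ^ n * esqrt (emeasure prior W) * ennreal b"
    by (simp add: nn_integral_cmult_indicator prior_space.emeasure_eq_measure b_def)
  also have "ennreal (b powr (-3/2)) * \<dots> = ennreal (b powr (-3/2) * b) * \<rho> ^ n * esqrt (emeasure prior W)"
    using b by (simp add: ennreal_mult mult_ac)
  also have "b powr (-3/2) * b = b powr (-3/2 + 1)"
    using b by (subst powr_add) simp
  finally show ?thesis by (simp add: b_def mult_left_mono)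
qed

text \<open>Countable subadditivity of the numerators over a common denominator. The condition on
  \<open>x\<close> makes the likelihood measurable in \<open>P\<close>, as the exchange of sum and
  integral requires.\<close>

lemma posterior_le_suminf:
  assumes x: "x \<in> space (Pi\<^sub>M UNIV (\<lambda>_::nat. mu))"
    and W: "\<And>i. W i \<in> sets prior" and V: "V \<subseteq> (\<Union>i. W i)"
  shows "posterior prior p n x V \<le> (\<Sum>i. posterior prior p n x (W i))"
proof -
  note W[measurable]
  have [measurable]: "(\<lambda>P. p P (x i)) \<in> borel_measurable prior" for i
  proof -
    have "x i \<in> space mu" using x by (auto simp: space_PiM)
    from measurable_compose[OF measurable_Pair1'[OF this] measurable_density_model]
    show ?thesis by simp
  qed
  have "indicator V P \<le> (\<Sum>i. indicator (W i) P :: ennreal)" for P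
  proof (cases "P \<in> V")
    case True
    then obtain i where "P \<in> W i" using V by auto
    then have "1 = (\<Sum>j\<in>{i}. indicator (W j) P :: ennreal)" by simp
    also have "\<dots> \<le> (\<Sum>j. indicator (W j) P)" by (intro sum_le_suminf) auto
    finally show ?thesis using True by simp
  qed simp
  then have "(\<integral>\<^sup>+P\<in>V. (\<Prod>i<n. p P (x i)) \<partial>prior) \<le> (\<integral>\<^sup>+P. (\<Prod>i<n. p P (x i)) * (\<Sum>i. indicator (W i) P) \<partial>prior)"
    by (intro nn_integral_mono mult_left_mono) auto
  also have "\<dots> = (\<integral>\<^sup>+P. (\<Sum>i. (\<Prod>i<n. p P (x i)) * indicator (W i) P) \<partial>prior)"
    by simp
  also have "\<dots> = (\<Sum>i. \<integral>\<^sup>+P\<in>W i. (\<Prod>i<n. p P (x i)) \<partial>prior)"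
    by (rule nn_integral_suminf) measurable
  finally show ?thesis
    unfolding posterior_def divide_ennreal_def by (simp add: mult_right_mono)
qed

end

section \<open>Summation over the cover and over the sample size\<close>

theorem corollary4p4:
  fixes mu P0 :: "'a measure"
    and prior :: "'a measure measure"
    and p :: "'a measure \<Rightarrow> 'a \<Rightarrow> ennreal"
    and V B :: "'a measure set"
    and W :: "nat \<Rightarrow> 'a measure set"
  assumes "dominated_model mu prior p"
    and "prob_space P0" and "sets P0 = sets mu"
    and "\<And>n. n \<ge> 1 \<Longrightarrow>
           absolutely_continuous (prior_predictive mu prior n) (Pi\<^sub>M {..<n} (\<lambda>_. P0))"
    and "V \<in> sets prior"
    and "\<And>i. W i \<in> sets prior" and "V \<subseteq> (\<Union>i. W i)"
    and "B \<in> sets prior" and "measure prior B > 0"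
    and "\<And>i P. P \<in> W i \<Longrightarrow> (SUP Q\<in>B. ratio_moment mu P0 P Q 1) < \<infinity>"
    and "(SUP i. SUP P\<in>convex_hull_measures (W i). SUP Q\<in>B. ratio_moment mu P0 P Q (1/2)) < 1"
    and "summable (\<lambda>i. measure prior (W i) powr (1/2))"
  shows "AE x in Pi\<^sub>M (UNIV :: nat set) (\<lambda>_. P0). (\<lambda>n. posterior prior p n x V) \<longlonglongrightarrow> 0"
proof -
  interpret dominated_model mu prior p by fact
  interpret P0: prob_space P0 by fact
  interpret X: product_prob_space "\<lambda>_::nat. P0" UNIV ..
  note W = assms(6) and B = assms(8,9)
  have ac: "absolutely_continuous mu P0"
    by (rule absolutely_continuous_if_predictive[OF assms(2,3) assms(4)]) simp
  let ?X = "Pi\<^sub>M (UNIV :: nat set) (\<lambda>_. P0)"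
  \<comment> \<open>The maximum with \<open>1/2\<close> makes \<open>\<rho>\<close> positive, as the
    product bound requires, and keeps it below one.\<close>
  define \<rho> where "\<rho> = max (ennreal (1/2)) (SUP i. SUP P\<in>convex_hull_measures (W i). SUP Q\<in>B. ratio_moment mu P0 P Q (1/2))"
  have "0 < ennreal (1/2)" by (subst ennreal_less_zero_iff) simp
  then have \<rho>0: "0 < \<rho>" unfolding \<rho>_def by (rule less_max_iff_disj[THEN iffD2, OF disjI1])
  have "ennreal (1/2) < 1"
    by (subst ennreal_1[symmetric], subst ennreal_less_iff) auto
  then have \<rho>1: "\<rho> < 1" using assms(11) unfolding \<rho>_def max_less_iff_conj by blast
  have H: "ratio_moment mu P0 R Q (1/2) \<le> \<rho>" if "Q \<in> B" "R \<in> convex_hull_measures (W i)" for Q R i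
    unfolding \<rho>_def
    by (rule max.coboundedI2, rule SUP_upper2[of i], simp, rule SUP_upper2[OF that(2)], rule SUP_upper[OF that(1)])
  obtain r where r: "0 \<le> r" "r < 1" and \<rho>: "\<rho> = ennreal r"
    using \<rho>1 by (cases \<rho> rule: ennreal_cases) auto
  define c where "c = ennreal (measure prior B powr (-1/2))"
  define s where "s = (\<Sum>i. measure prior (W i) powr (1/2))"
  have sW: "(\<Sum>i. esqrt (emeasure prior (W i))) = ennreal s"
  proof -
    have "esqrt (emeasure prior (W i)) = ennreal (measure prior (W i) powr (1/2))" for i
      by (simp add: prior_space.emeasure_eq_measure esqrt_ennreal powr_half_sqrt)
    then show ?thesis
      unfolding s_def using suminf_ennreal2[OF powr_ge_zero assms(12)] by (simp only:)
  qed
  \<comment> \<open>The posterior after \<open>n\<close> observations depends on the first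
    \<open>n\<close> coordinates alone, so its mean under the infinite product is the one under the
    \<open>n\<close>-fold product.\<close>
  have post: "(\<integral>\<^sup>+x. posterior prior p n x A \<partial>?X) = (\<integral>\<^sup>+x. posterior prior p n x A \<partial>(Pi\<^sub>M {..<n} (\<lambda>_. P0)))"
    and meas [measurable]: "(\<lambda>x. posterior prior p n x A) \<in> borel_measurable ?X"
    if A: "A \<in> sets prior" for A n
  proof -
    have restr: "posterior prior p n x A = posterior prior p n (restrict x {..<n}) A" for x
      by (simp add: posterior_def)
    have R: "(\<lambda>x. restrict x {..<n}) \<in> ?X \<rightarrow>\<^sub>M Pi\<^sub>M {..<n} (\<lambda>_. P0)"
      by (intro measurable_restrict_subset) simp
    note M = borel_measurable_posterior[OF assms(3) A, of n]
    show "(\<lambda>x. posterior prior p n x A) \<in> borel_measurable ?X"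
      using measurable_compose[OF R M] by (simp only: restr[symmetric])
    have "(\<integral>\<^sup>+x. posterior prior p n x A \<partial>(Pi\<^sub>M {..<n} (\<lambda>_. P0))) =
      (\<integral>\<^sup>+x. posterior prior p n x A \<partial>distr ?X (Pi\<^sub>M {..<n} (\<lambda>_. P0)) (\<lambda>x. restrict x {..<n}))"
      by (subst X.distr_PiM_restrict_finite) auto
    also have "\<dots> = (\<integral>\<^sup>+x. posterior prior p n (restrict x {..<n}) A \<partial>?X)"
      by (intro nn_integral_distr R) (use M in simp)
    finally show "(\<integral>\<^sup>+x. posterior prior p n x A \<partial>?X) = (\<integral>\<^sup>+x. posterior prior p n x A \<partial>(Pi\<^sub>M {..<n} (\<lambda>_. P0)))"
      by (simp only: restr[symmetric])
  qed
  \<comment> \<open>Summing the bounds for the \<open>W i\<close> collects the square roots of the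
    prior masses into \<open>s\<close>, finite by the summability condition; what remains is
    geometric in \<open>n\<close>.\<close>
  have bound: "(\<integral>\<^sup>+x. posterior prior p n x V \<partial>?X) \<le> c * ennreal s * ennreal (r ^ n)" for n
  proof -
    have sp: "space ?X = space (Pi\<^sub>M UNIV (\<lambda>_::nat. mu))"
      using sets_eq_imp_space_eq[OF assms(3)] by (simp add: space_PiM)
    have Wi: "(\<integral>\<^sup>+x. posterior prior p n x (W i) \<partial>?X) \<le> c * \<rho> ^ n * esqrt (emeasure prior (W i))" for i
      using nn_integral_posterior_le[OF assms(2,3) ac W B \<rho>0 H] by (simp only: post[OF W] c_def)
    have "(\<integral>\<^sup>+x. posterior prior p n x V \<partial>?X) \<le> (\<integral>\<^sup>+x. (\<Sum>i. posterior prior p n x (W i)) \<partial>?X)"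
      by (intro nn_integral_mono posterior_le_suminf assms) (simp add: sp)
    also have "\<dots> = (\<Sum>i. \<integral>\<^sup>+x. posterior prior p n x (W i) \<partial>?X)"
      using W by (intro nn_integral_suminf meas)
    also have "\<dots> \<le> (\<Sum>i. c * \<rho> ^ n * esqrt (emeasure prior (W i)))"
      by (rule suminf_le[OF Wi summableI summableI])
    also have "\<dots> = c * ennreal s * ennreal (r ^ n)"
      using r by (simp add: sW \<rho> ennreal_power mult_ac)
    finally show ?thesis .
  qed
  \<comment> \<open>As in the Borel-Cantelli lemma, a finite mean of the whole series makes it
    finite almost surely.\<close>
  have "(\<integral>\<^sup>+x. (\<Sum>n. posterior prior p n x V) \<partial>?X) = (\<Sum>n. \<integral>\<^sup>+x. posterior prior p n x V \<partial>?X)"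
    using assms(5) by (intro nn_integral_suminf meas)
  also have "\<dots> \<le> (\<Sum>n. c * ennreal s * ennreal (r ^ n))"
    by (rule suminf_le[OF bound summableI summableI])
  also have "\<dots> = c * ennreal s * ennreal (\<Sum>n. r ^ n)"
    using r by (simp add: suminf_ennreal2 summable_geometric)
  also have "\<dots> < top"
    by (simp add: c_def ennreal_mult_less_top)
  finally have "AE x in ?X. (\<Sum>n. posterior prior p n x V) \<noteq> top"
    using meas[OF assms(5)]
    by (intro nn_integral_PInf_AE[unfolded infinity_ennreal_def]) auto
  then show ?thesis
    by eventually_elim (rule tendsto_0_of_suminf_ennreal)
qed

end
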